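(* For every $h\in[H+1]$, every $s\in\mathcal S$ and every $b\in\mathcal B$, $\hat V^*_h(s,\lceil b\rceil_\ell)\ge\bar V^*_h(s,b)$.
   Context: Cost-accumulating MDP. Fix $H,m\in\mathbb N$. A finite-horizon tabular cost-accumulating MDP consists of: - states $\mathcal S=\{1,\dots,S\}$; - finite action sets $\mathcal A_h(s)$; - transitions $P_h(\cdot\mid s,a)$; - expected rewards $r_h(s,a)$; - deterministic costs $c_h(s,a)\in\mathbb R^m$; - an initial state $s_0$. Vector inequalities are componentwise, and a scalar added to a vector is added to every coordinate. SR functions. Let $f:\mathbb R^m\times\mathbb R^m\to\mathbb R^m$ satisfy: - $f$ is associative; - $f$ is componentwise non-decreasing in each argument; - $f$ is $1$-Lipschitz in each argument for $\|\cdot\|_\infty$; - $f(0,x)=f(x,0)=x$. Let $g:[0,1]\to[0,1]$ satisfy $g(0)=0$. Write $f_{s'}y_{s'}=f(y_1,f(y_2,\dots,y_S))$. Assume $x\mapsto f_{s'}g(p_{s'})x_{s'}$ is $1$-Lipschitz for $\|\cdot\|_\infty$ for every probability vector $p$. SR cost. For deterministic history-dependent policies, $C^\pi_{H+1}\equiv0$ and $C^\pi_h(\tau_h)=c_h(s,a)+f_{s'}g(P_h(s'\mid s,a))C^\pi_{h+1}(\tau_h,a,s')$. $\mathcal B$ is the finite set of all values $C^\pi_h(\tau_h)$. Reduced optimal values. $\bar V^*_{H+1}(s,b)=0$ if $b\ge0$, else $-\infty$. For $h\in[H]$, $\bar V^*_h(s,b)$ is the max of $r_h(s,a)+\sum_{s':P_h(s'|s,a)>0}P_h(s'\mid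 s,a)\bar V^*_{h+1}(s',b_{s'})$ over $a\in\mathcal A_h(s)$ and $\mathbf b\in\mathcal B^S$ with $c_h(s,a)+f_{s'}g(P_h(s'\mid s,a))b_{s'}\le b$ (with $\max\emptyset=-\infty$). Approximate MDP with parameter $\ell>0$. - Rounding is $\lceil x\rceil_\ell=\lceil x/\ell\rceil\ell$ componentwise, and $\kappa(x)=x+\ell(S+1)$. - Fix $b_{\min}\le b_{\max}$ in $\mathbb R^m$ with $\mathcal B\subseteq[b_{\min},b_{\max}]$, and let $\hat{\mathcal B}=\{\lceil b\rceil_\ell:b\in[b_{\min},b_{\max}]\}$. - For $\hat{\mathbf b}\in\hat{\mathcal B}^S$ let $\hat f^{s,a}_{h,\hat{\mathbf b}}(S+1,F)=F$ and $\hat f^{s,a}_{h,\hat{\mathbf b}}(t,F)=\hat f^{s,a}_{h,\hat{\mathbf b}}(t+1,\lceil f(F,g(P_h(t\mid s,a))\hat b_t)\rceil_\ell)$. - The allowed actions at $(s,\hat b)$ are the pairs $(a,\hat{\mathbf b})\in\mathcal A_h(s)\times\hat{\mathcal B}^S$ with $c_h(s,a)+\hat f^{s,a}_{h,\hat{\mathbf b}}(1,0)\le\kappa(\hat b)$; we write $\hat{\mathcal A}_h(s,\hat b)$ for this set. - The optimal values are $\hat V^*_{H+1}(s,\hat b)=0$ if $\hat b\ge0$ and $-\infty$ otherwise, and $\hat V^*_h(s,\hat b)=\max_{(a,\hat{\mathbf b})\in\hat{\mathcal A}_h(s,\hat b)}[r_h(s,a)+\sum_{s':P_h(s'|s,a)>0}P_h(s'\mid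 s,a)\hat V^*_{h+1}(s',\hat b_{s'})]$. *)

theory Defs
  imports "HOL-Analysis.Analysis"
begin

text \<open>
  The cost dimension is the cardinality of the index type \<^typ>\<open>'m\<close>, so costs live in
  \<^typ>\<open>real ^ 'm\<close>, whose order is componentwise. States are the natural numbers
  \<open>1, \<dots>, num_states M\<close>; steps are numbered from 1.
\<close>

record ('a, 'm::finite) ca_mdp =
  horizon :: nat
  num_states :: nat
  actions :: "nat \<Rightarrow> nat \<Rightarrow> 'a set"
  trans_prob :: "nat \<Rightarrow> nat \<Rightarrow> 'a \<Rightarrow> nat \<Rightarrow> real"
  reward :: "nat \<Rightarrow> nat \<Rightarrow> 'a \<Rightarrow> real"
  cost :: "nat \<Rightarrow> nat \<Rightarrow> 'a \<Rightarrow> real ^ 'm"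
  init_state :: nat

definition states :: "('a, 'm::finite) ca_mdp \<Rightarrow> nat set" where
  "states M = {1..num_states M}"

definition prob_vector :: "nat \<Rightarrow> (nat \<Rightarrow> real) \<Rightarrow> bool" where
  "prob_vector S p \<longleftrightarrow> (\<forall>s\<in>{1..S}. 0 \<le> p s) \<and> (\<Sum>s\<in>{1..S}. p s) = 1"

definition valid_ca_mdp :: "('a, 'm::finite) ca_mdp \<Rightarrow> bool" where
  "valid_ca_mdp M \<longleftrightarrow>
     init_state M \<in> states M \<and>
     (\<forall>h\<in>{1..horizon M}. \<forall>s\<in>states M.
        finite (actions M h s) \<and>
        (\<forall>a\<in>actions M h s. prob_vector (num_states M) (trans_prob M h s a)))"

text \<open>\<open>f\<close> applied along the states: \<open>f (y 1) (f (y 2) (\<dots> (f (y (S - 1)) (y S))))\<close>.\<close>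

definition f_iter :: "('v \<Rightarrow> 'v \<Rightarrow> 'v) \<Rightarrow> nat \<Rightarrow> (nat \<Rightarrow> 'v) \<Rightarrow> 'v" where
  "f_iter f S y = foldr f (map y [1..<S]) (y S)"

text \<open>The supremum norm on \<open>S\<close>-tuples of vectors (all \<open>S \<cdot> CARD('m)\<close> coordinates).\<close>

definition tuple_infnorm :: "nat \<Rightarrow> (nat \<Rightarrow> real ^ 'm) \<Rightarrow> real" where
  "tuple_infnorm S x = Max ((\<lambda>s. infnorm (x s)) ` {1..S})"

definition sr_functions ::
  "nat \<Rightarrow> (real ^ 'm \<Rightarrow> real ^ 'm \<Rightarrow> real ^ 'm) \<Rightarrow> (real \<Rightarrow> real) \<Rightarrow> bool" where
  "sr_functions S f g \<longleftrightarrow>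
     (\<forall>x y z. f (f x y) z = f x (f y z)) \<and>
     (\<forall>x x' y. x \<le> x' \<longrightarrow> f x y \<le> f x' y) \<and>
     (\<forall>x y y'. y \<le> y' \<longrightarrow> f x y \<le> f x y') \<and>
     (\<forall>x x' y. infnorm (f x y - f x' y) \<le> infnorm (x - x')) \<and>
     (\<forall>x y y'. infnorm (f x y - f x y') \<le> infnorm (y - y')) \<and>
     (\<forall>x. f 0 x = x \<and> f x 0 = x) \<and>
     (\<forall>p\<in>{0..1}. g p \<in> {0..1}) \<and>
     g 0 = 0 \<and>
     (\<forall>p. prob_vector S p \<longrightarrow>
        (\<forall>x y. infnorm (f_iter f S (\<lambda>s. g (p s) *\<^sub>R x s) - f_iter f S (\<lambda>s. g (p s) *\<^sub>R y s))
               \<le> tuple_infnorm S (\<lambda>s. x s - y s)))"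

text \<open>\<open>Ext \<tau> a s'\<close> is the history \<open>(\<tau>, a, s')\<close>.\<close>

datatype 'a history = Start nat | Ext "'a history" 'a nat

primrec cur_state :: "'a history \<Rightarrow> nat" where
  "cur_state (Start s) = s"
| "cur_state (Ext \<tau> a s) = s"

inductive is_history :: "('a, 'm::finite) ca_mdp \<Rightarrow> nat \<Rightarrow> 'a history \<Rightarrow> bool" for M where
  start: "is_history M 1 (Start (init_state M))"
| ext: "is_history M h \<tau> \<Longrightarrow> h \<le> horizon M \<Longrightarrow> a \<in> actions M h (cur_state \<tau>) \<Longrightarrow> s' \<in> states M
    \<Longrightarrow> is_history M (Suc h) (Ext \<tau> a s')"

definition is_policy :: "('a, 'm::finite) ca_mdp \<Rightarrow> (nat \<Rightarrow> 'a history \<Rightarrow> 'a) \<Rightarrow> bool" where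
  "is_policy M \<pi> \<longleftrightarrow>
     (\<forall>h\<in>{1..horizon M}. \<forall>\<tau>. is_history M h \<tau> \<longrightarrow> \<pi> h \<tau> \<in> actions M h (cur_state \<tau>))"

function sr_cost ::
  "('a, 'm::finite) ca_mdp \<Rightarrow> (real ^ 'm \<Rightarrow> real ^ 'm \<Rightarrow> real ^ 'm) \<Rightarrow> (real \<Rightarrow> real) \<Rightarrow>
   (nat \<Rightarrow> 'a history \<Rightarrow> 'a) \<Rightarrow> nat \<Rightarrow> 'a history \<Rightarrow> real ^ 'm" where
  "sr_cost M f g \<pi> h \<tau> =
     (if h > horizon M then 0
      else cost M h (cur_state \<tau>) (\<pi> h \<tau>) +
           f_iter f (num_states M)
             (\<lambda>s'. g (trans_prob M h (cur_state \<tau>) (\<pi> h \<tau>) s')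
                     *\<^sub>R sr_cost M f g \<pi> (Suc h) (Ext \<tau> (\<pi> h \<tau>) s')))"
  by pat_completeness auto
termination
  by (relation "Wellfounded.measure (\<lambda>(M, f, g, \<pi>, h, \<tau>). Suc (horizon M) - h)") auto

declare sr_cost.simps [simp del]

definition cost_values ::
  "('a, 'm::finite) ca_mdp \<Rightarrow> (real ^ 'm \<Rightarrow> real ^ 'm \<Rightarrow> real ^ 'm) \<Rightarrow> (real \<Rightarrow> real) \<Rightarrow>
   (real ^ 'm) set" where
  "cost_values M f g =
     {sr_cost M f g \<pi> h \<tau> | \<pi> h \<tau>. is_policy M \<pi> \<and> h \<in> {1..horizon M + 1} \<and> is_history M h \<tau>}"

text \<open>
  Maximum of a finite set of extended reals, with the convention \<open>max \<emptyset> = -\<infinity>\<close>. Tuples range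
  over extensional functions below, so that all sets to which it is applied are finite; see
  \<open>finite_cost_values\<close> and \<open>finite_approx_budgets\<close>.
\<close>

definition max_val :: "ereal set \<Rightarrow> ereal" where
  "max_val X = (if X = {} then -\<infinity> else Max X)"

function V_bar ::
  "('a, 'm::finite) ca_mdp \<Rightarrow> (real ^ 'm \<Rightarrow> real ^ 'm \<Rightarrow> real ^ 'm) \<Rightarrow> (real \<Rightarrow> real) \<Rightarrow>
   nat \<Rightarrow> nat \<Rightarrow> real ^ 'm \<Rightarrow> ereal" where
  "V_bar M f g h s b =
     (if h > horizon M then (if 0 \<le> b then 0 else -\<infinity>)
      else max_val
        {ereal (reward M h s a) +
           (\<Sum>s'\<in>{s' \<in> states M. trans_prob M h s a s' > 0}.
              ereal (trans_prob M h s a s') * V_bar M f g (Suc h) s' (bs s')) | a bs.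
         a \<in> actions M h s \<and> bs \<in> states M \<rightarrow>\<^sub>E cost_values M f g \<and>
         cost M h s a + f_iter f (num_states M) (\<lambda>s'. g (trans_prob M h s a s') *\<^sub>R bs s') \<le> b})"
  by pat_completeness auto
termination
  by (relation "Wellfounded.measure (\<lambda>(M, f, g, h, s, b). Suc (horizon M) - h)") auto

declare V_bar.simps [simp del]

definition round_up :: "real \<Rightarrow> real ^ 'm \<Rightarrow> real ^ 'm" where
  "round_up l x = (\<chi> i. of_int \<lceil>x $ i / l\<rceil> * l)"

definition kappa :: "('a, 'm::finite) ca_mdp \<Rightarrow> real \<Rightarrow> real ^ 'm \<Rightarrow> real ^ 'm" where
  "kappa M l x = (\<chi> i. x $ i + l * (real (num_states M) + 1))"

definition approx_budgets ::
  "real \<Rightarrow> real ^ 'm \<Rightarrow> real ^ 'm \<Rightarrow> (real ^ 'm::finite) set" where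
  "approx_budgets l bmin bmax = round_up l ` {bmin..bmax}"

function f_hat ::
  "('a, 'm::finite) ca_mdp \<Rightarrow> (real ^ 'm \<Rightarrow> real ^ 'm \<Rightarrow> real ^ 'm) \<Rightarrow> (real \<Rightarrow> real) \<Rightarrow> real \<Rightarrow>
   nat \<Rightarrow> nat \<Rightarrow> 'a \<Rightarrow> (nat \<Rightarrow> real ^ 'm) \<Rightarrow> nat \<Rightarrow> real ^ 'm \<Rightarrow> real ^ 'm" where
  "f_hat M f g l h s a bs t F =
     (if t > num_states M then F
      else f_hat M f g l h s a bs (Suc t)
             (round_up l (f F (g (trans_prob M h s a t) *\<^sub>R bs t))))"
  by pat_completeness auto
termination
  by (relation "Wellfounded.measure (\<lambda>(M, f, g, l, h, s, a, bs, t, F). Suc (num_states M) - t)") auto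

declare f_hat.simps [simp del]

definition approx_actions ::
  "('a, 'm::finite) ca_mdp \<Rightarrow> (real ^ 'm \<Rightarrow> real ^ 'm \<Rightarrow> real ^ 'm) \<Rightarrow> (real \<Rightarrow> real) \<Rightarrow>
   real \<Rightarrow> real ^ 'm \<Rightarrow> real ^ 'm \<Rightarrow> nat \<Rightarrow> nat \<Rightarrow> real ^ 'm \<Rightarrow> ('a \<times> (nat \<Rightarrow> real ^ 'm)) set" where
  "approx_actions M f g l bmin bmax h s b =
     {(a, bs). a \<in> actions M h s \<and> bs \<in> states M \<rightarrow>\<^sub>E approx_budgets l bmin bmax \<and>
               cost M h s a + f_hat M f g l h s a bs 1 0 \<le> kappa M l b}"

function V_hat ::
  "('a, 'm::finite) ca_mdp \<Rightarrow> (real ^ 'm \<Rightarrow> real ^ 'm \<Rightarrow> real ^ 'm) \<Rightarrow> (real \<Rightarrow> real) \<Rightarrow>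
   real \<Rightarrow> real ^ 'm \<Rightarrow> real ^ 'm \<Rightarrow> nat \<Rightarrow> nat \<Rightarrow> real ^ 'm \<Rightarrow> ereal" where
  "V_hat M f g l bmin bmax h s b =
     (if h > horizon M then (if 0 \<le> b then 0 else -\<infinity>)
      else max_val
        {ereal (reward M h s a) +
           (\<Sum>s'\<in>{s' \<in> states M. trans_prob M h s a s' > 0}.
              ereal (trans_prob M h s a s') * V_hat M f g l bmin bmax (Suc h) s' (bs s')) | a bs.
         (a, bs) \<in> approx_actions M f g l bmin bmax h s b})"
  by pat_completeness auto
termination
  by (relation "Wellfounded.measure (\<lambda>(M, f, g, l, bmin, bmax, h, s, b). Suc (horizon M) - h)") auto

declare V_hat.simps [simp del]

lemma f_iter_cong:
  assumes "S \<ge> 1" "\<And>s. s \<in> {1..S} \<Longrightarrow> y s = z s"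
  shows "f_iter f S y = f_iter f S z"
proof -
  have "map y [1..<S] = map z [1..<S]" using assms by auto
  moreover have "y S = z S" using assms by auto
  ultimately show ?thesis unfolding f_iter_def by (simp only:)
qed

lemma is_history_cur_state:
  "is_history M h \<tau> \<Longrightarrow> init_state M \<in> states M \<Longrightarrow> cur_state \<tau> \<in> states M"
  by (induction rule: is_history.induct) auto

lemma finite_cost_values:
  assumes M: "valid_ca_mdp M"
  shows "finite (cost_values M f g)"
proof -
  let ?S = "num_states M"
  have init: "init_state M \<in> states M" using M by (simp add: valid_ca_mdp_def)
  then have S1: "?S \<ge> 1" by (simp add: states_def)
  define X where "X h = {sr_cost M f g \<pi> h \<tau> | \<pi> \<tau>. is_policy M \<pi> \<and> is_history M h \<tau>}" for h
  have fin: "finite (X h)" if "1 \<le> h" "h \<le> Suc (horizon M)" for h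
    using that(2,1)
  proof (induction h rule: inc_induct)
    case base
    have "X (Suc (horizon M)) \<subseteq> {0}" by (auto simp: X_def sr_cost.simps)
    then show ?case using finite_subset by blast
  next
    case (step h)
    then have h: "h \<in> {1..horizon M}" and IH: "finite (X (Suc h))" by auto
    let ?D = "SIGMA s:states M. actions M h s \<times> (states M \<rightarrow>\<^sub>E X (Suc h))"
    let ?F = "\<lambda>(s, a, y). cost M h s a + f_iter f ?S (\<lambda>s'. g (trans_prob M h s a s') *\<^sub>R y s')"
    have "finite ?D"
      using M h IH by (intro finite_SigmaI finite_cartesian_product finite_PiE)
        (auto simp: valid_ca_mdp_def states_def)
    moreover have "X h \<subseteq> ?F ` ?D"
    proof
      fix v assume "v \<in> X h"
      then obtain \<pi> \<tau> where p: "is_policy M \<pi>" and t: "is_history M h \<tau>"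
        and v: "v = sr_cost M f g \<pi> h \<tau>" by (auto simp: X_def)
      define a where "a = \<pi> h \<tau>"
      have a: "a \<in> actions M h (cur_state \<tau>)" using p t h by (auto simp: is_policy_def a_def)
      define y where "y = restrict (\<lambda>s'. sr_cost M f g \<pi> (Suc h) (Ext \<tau> a s')) (states M)"
      have "y \<in> states M \<rightarrow>\<^sub>E X (Suc h)"
        using p is_history.ext[OF t _ a] h by (auto simp: y_def X_def)
      moreover have "v = ?F (cur_state \<tau>, a, y)"
        using h S1 unfolding v
        by (subst sr_cost.simps) (auto simp: a_def y_def states_def intro!: f_iter_cong)
      ultimately show "v \<in> ?F ` ?D"
        using a is_history_cur_state[OF t init] by blast
    qed
    ultimately show ?case using finite_subset by blast
  qed
  have "cost_values M f g \<subseteq> (\<Union>h\<in>{1..horizon M + 1}. X h)"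
    unfolding cost_values_def X_def by blast
  then show ?thesis by (rule finite_subset) (use fin in auto)
qed

lemma finite_approx_budgets:
  assumes "l > 0"
  shows "finite (approx_budgets l bmin bmax)"
proof -
  let ?I = "\<lambda>i. (\<lambda>k. of_int k * l) ` {\<lceil>bmin $ i / l\<rceil>..\<lceil>bmax $ i / l\<rceil>}"
  have "approx_budgets l bmin bmax \<subseteq> vec_lambda ` (PiE UNIV ?I)"
  proof
    fix v assume "v \<in> approx_budgets l bmin bmax"
    then obtain b where "b \<in> {bmin..bmax}" and v: "v = round_up l b"
      by (auto simp: approx_budgets_def)
    then have "\<lceil>b $ i / l\<rceil> \<in> {\<lceil>bmin $ i / l\<rceil>..\<lceil>bmax $ i / l\<rceil>}" for i
      using assms by (auto simp: less_eq_vec_def intro!: ceiling_mono divide_right_mono)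
    then show "v \<in> vec_lambda ` (PiE UNIV ?I)"
      unfolding v round_up_def by (intro imageI PiE_I) auto
  qed
  then show ?thesis by (rule finite_subset) (intro finite_imageI finite_PiE; auto)
qed

end

theory Submission
  imports Defs
begin

text \<open>
  Rounding a feasible tuple of budgets up keeps it feasible in the approximate MDP, because the
  slack \<open>l * (S + 1)\<close> in \<open>kappa\<close> pays for all rounding errors: one \<open>l\<close> for rounding the
  tuple itself (\<open>x \<mapsto> f_iter f S (\<lambda>s. g (p s) *\<^sub>R x s)\<close> is nonexpansive) and one for each
  of the \<open>S\<close> roundings inside \<open>f_hat\<close> (\<open>f\<close> is nonexpansive in its first argument, so an
  error in the accumulator is not amplified by the later steps). Backward induction on the
  step then compares the values.
\<close>

lemma infnorm_leI:
  fixes x :: "real ^ 'm"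
  assumes "\<And>i. \<bar>x $ i\<bar> \<le> e"
  shows "infnorm x \<le> e"
  using assms by (auto simp: infnorm_cart intro!: cSup_least)

lemma nth_le_of_infnorm_diff_le:
  fixes x y :: "real ^ 'm"
  assumes "infnorm (x - y) \<le> e"
  shows "x $ i \<le> y $ i + e"
  using component_le_infnorm_cart[of "x - y" i] assms by simp

lemma round_up_nth_bounds:
  fixes x :: "real ^ 'm"
  assumes "l > 0"
  shows "x $ i \<le> round_up l x $ i" "round_up l x $ i \<le> x $ i + l"
proof -
  show "x $ i \<le> round_up l x $ i"
    using assms by (simp add: round_up_def flip: pos_divide_le_eq)
  have "of_int \<lceil>x $ i / l\<rceil> * l \<le> (x $ i / l + 1) * l"
    using assms of_int_ceiling_le_add_one by (intro mult_right_mono) auto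
  then show "round_up l x $ i \<le> x $ i + l"
    using assms by (simp add: round_up_def distrib_right)
qed

lemma infnorm_round_up_diff_le:
  fixes x :: "real ^ 'm"
  assumes "l > 0"
  shows "infnorm (round_up l x - x) \<le> l"
proof (rule infnorm_leI)
  show "\<bar>(round_up l x - x) $ i\<bar> \<le> l" for i
    using round_up_nth_bounds[OF assms, of x i] by simp
qed

lemma foldl_infnorm_nonexpansive:
  fixes f :: "real ^ 'm \<Rightarrow> real ^ 'm \<Rightarrow> real ^ 'm"
  assumes "\<And>x x' y. infnorm (f x y - f x' y) \<le> infnorm (x - x')"
  shows "infnorm (foldl f x ys - foldl f x' ys) \<le> infnorm (x - x')"
proof (induction ys arbitrary: x x')
  case (Cons y ys)
  have "infnorm (foldl f (f x y) ys - foldl f (f x' y) ys) \<le> infnorm (f x y - f x' y)"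
    by (rule Cons.IH)
  also have "\<dots> \<le> infnorm (x - x')" by (rule assms)
  finally show ?case by simp
qed simp

text \<open>\<open>f_hat\<close> accumulates from the left starting at a unit, whereas
  \<open>f_iter\<close> nests to the right and has no start value. Associativity rebrackets and the
  unit law absorbs the start. At \<open>S = 0\<close> the two conventions would give
  \<open>e\<close> and \<open>y 0\<close>.\<close>

lemma foldl_eq_f_iter:
  assumes assoc: "\<And>x y z. f (f x y) z = f x (f y z)"
    and unit: "\<And>x. f e x = x"
    and "S \<ge> 1"
  shows "foldl f e (map y [1..<Suc S]) = f_iter f S y"
proof -
  \<comment> \<open>The start \<open>x\<close> must stay arbitrary, since each step of the left fold
    changes it.\<close>
  have *: "f (foldl f x ys) z = f x (foldr f ys z)" for x z ys
    by (induction ys arbitrary: x) (auto simp: assoc)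
  show ?thesis using \<open>S \<ge> 1\<close> *[of e "map y [1..<S]" "y S"] by (simp add: f_iter_def unit)
qed

text \<open>Counts roundings: each index from \<open>t\<close> to the last state costs at most
  \<open>l\<close>. The downward induction keeps \<open>F\<close> arbitrary because the recursive
  call starts from a rounded accumulator.\<close>

lemma f_hat_nth_le:
  fixes M :: "('a, 'm::finite) ca_mdp"
  assumes lip: "\<And>x x' y. infnorm (f x y - f x' y) \<le> infnorm (x - x')"
    and "l > 0" and "t \<le> Suc (num_states M)"
  shows "f_hat M f g l h s a bs t F $ i
    \<le> foldl f F (map (\<lambda>s'. g (trans_prob M h s a s') *\<^sub>R bs s') [t..<Suc (num_states M)]) $ i
       + l * real (Suc (num_states M) - t)"
  using assms(3)
proof (induction t arbitrary: F rule: inc_induct)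
  case base
  then show ?case by (simp add: f_hat.simps)
next
  case (step t)
  let ?S = "num_states M" and ?y = "\<lambda>s'. g (trans_prob M h s a s') *\<^sub>R bs s'"
  let ?F = "f F (?y t)"
  have "f_hat M f g l h s a bs t F $ i = f_hat M f g l h s a bs (Suc t) (round_up l ?F) $ i"
    using step.hyps by (subst f_hat.simps) auto
  also have "\<dots> \<le> foldl f (round_up l ?F) (map ?y [Suc t..<Suc ?S]) $ i + l * real (Suc ?S - Suc t)"
    by (rule step.IH)
  \<comment> \<open>The starts \<open>round_up l ?F\<close> and \<open>?F\<close> are within
    \<open>l\<close> in the sup norm, and folding the same tail does not enlarge this
    distance.\<close>
  also have "foldl f (round_up l ?F) (map ?y [Suc t..<Suc ?S]) $ i
      \<le> foldl f ?F (map ?y [Suc t..<Suc ?S]) $ i + l"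
    using foldl_infnorm_nonexpansive[of f, OF lip] infnorm_round_up_diff_le[OF \<open>l > 0\<close>]
    by (intro nth_le_of_infnorm_diff_le) (rule order_trans)
  also have "foldl f ?F (map ?y [Suc t..<Suc ?S]) = foldl f F (map ?y [t..<Suc ?S])"
    using step.hyps by (subst (2) upt_conv_Cons) auto
  also have "foldl f F (map ?y [t..<Suc ?S]) $ i + l + l * real (Suc ?S - Suc t)
      = foldl f F (map ?y [t..<Suc ?S]) $ i + l * real (Suc ?S - t)"
    using step.hyps by (simp add: Suc_diff_le of_nat_diff algebra_simps)
  finally show ?case by simp
qed

lemma max_val_mono:
  assumes "finite A" "finite B" "\<And>x. x \<in> A \<Longrightarrow> \<exists>y\<in>B. x \<le> y"
  shows "max_val A \<le> max_val B"
proof (cases "A = {}")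
  case False
  then obtain y where "y \<in> B" "Max A \<le> y" using assms(1,3) Max_in by blast
  then have "Max A \<le> Max B" using assms(2) Max_ge order_trans by blast
  with False \<open>y \<in> B\<close> show ?thesis by (auto simp: max_val_def)
qed (simp add: max_val_def)

text \<open>Supplies the witness for the value comparison. The box hypothesis on \<open>bs\<close>
  puts the rounded entries into \<open>approx_budgets\<close>; the tuple is restricted because
  \<open>approx_actions\<close> demands extensional functions.\<close>

lemma round_up_mem_approx_actions:
  fixes M :: "('a, 'm::finite) ca_mdp"
  assumes sr: "sr_functions (num_states M) f g" and l: "l > 0"
    and prob: "prob_vector (num_states M) (trans_prob M h s a)"
    and S: "num_states M \<ge> 1"
    and a: "a \<in> actions M h s"
    and bs: "bs \<in> states M \<rightarrow> {bmin..bmax}"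
    and feasible:
      "cost M h s a + f_iter f (num_states M) (\<lambda>s'. g (trans_prob M h s a s') *\<^sub>R bs s') \<le> b"
  shows "(a, restrict (\<lambda>s'. round_up l (bs s')) (states M))
    \<in> approx_actions M f g l bmin bmax h s (round_up l b)"
proof -
  let ?S = "num_states M" and ?p = "trans_prob M h s a"
  define bs' where "bs' = restrict (\<lambda>s'. round_up l (bs s')) (states M)"
  have "tuple_infnorm ?S (\<lambda>s'. bs' s' - bs s') \<le> l"
    using S infnorm_round_up_diff_le[OF l]
    by (auto simp: tuple_infnorm_def bs'_def states_def)
  moreover have "infnorm (f_iter f ?S (\<lambda>s'. g (?p s') *\<^sub>R bs' s')
      - f_iter f ?S (\<lambda>s'. g (?p s') *\<^sub>R bs s')) \<le> tuple_infnorm ?S (\<lambda>s'. bs' s' - bs s')"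
    using sr prob by (auto simp: sr_functions_def)
  ultimately have iter: "f_iter f ?S (\<lambda>s'. g (?p s') *\<^sub>R bs' s') $ i
      \<le> f_iter f ?S (\<lambda>s'. g (?p s') *\<^sub>R bs s') $ i + l" for i
    by (intro nth_le_of_infnorm_diff_le) (rule order_trans)
  have fold: "foldl f 0 (map (\<lambda>s'. g (?p s') *\<^sub>R bs' s') [1..<Suc ?S])
      = f_iter f ?S (\<lambda>s'. g (?p s') *\<^sub>R bs' s')"
    using sr S by (intro foldl_eq_f_iter) (auto simp: sr_functions_def)
  \<comment> \<open>Starting at \<open>t = 1\<close> leaves exactly \<open>?S\<close>
    roundings.\<close>
  have hat: "f_hat M f g l h s a bs' 1 0 $ i
      \<le> f_iter f ?S (\<lambda>s'. g (?p s') *\<^sub>R bs' s') $ i + l * real ?S" for i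
    using f_hat_nth_le[of f l 1 M g h s a bs' 0 i] sr l unfolding fold
    by (simp add: sr_functions_def)
  have "cost M h s a + f_hat M f g l h s a bs' 1 0 \<le> kappa M l (round_up l b)"
    unfolding less_eq_vec_def
  proof
    fix i
    have "cost M h s a $ i + f_iter f ?S (\<lambda>s'. g (?p s') *\<^sub>R bs s') $ i \<le> b $ i"
      using feasible by (auto simp: less_eq_vec_def)
    \<comment> \<open>The errors \<open>l\<close> from \<open>iter\<close> and \<open>l * ?S\<close>
      from \<open>hat\<close> add up to the slack in \<open>kappa\<close>, and \<open>b\<close> lies
      below its own rounding.\<close>
    then show "(cost M h s a + f_hat M f g l h s a bs' 1 0) $ i \<le> kappa M l (round_up l b) $ i"
      using hat[of i] iter[of i] round_up_nth_bounds(1)[OF l, of b i]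
      by (simp add: kappa_def algebra_simps)
  qed
  moreover have "bs' \<in> states M \<rightarrow>\<^sub>E approx_budgets l bmin bmax"
    using bs by (auto simp: bs'_def approx_budgets_def)
  ultimately show ?thesis using a by (simp add: approx_actions_def bs'_def)
qed

theorem mainTheorem9:
  fixes M :: "('a, 'm::finite) ca_mdp"
    and f :: "real ^ 'm \<Rightarrow> real ^ 'm \<Rightarrow> real ^ 'm"
    and g :: "real \<Rightarrow> real"
    and l :: real
    and bmin bmax b :: "real ^ 'm"
    and h s :: nat
  assumes "valid_ca_mdp M"
    and "sr_functions (num_states M) f g"
    and "l > 0"
    and "bmin \<le> bmax"
    and "cost_values M f g \<subseteq> {bmin..bmax}"
    and "h \<in> {1..horizon M + 1}"
    and "s \<in> states M"
    and "b \<in> cost_values M f g"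
  shows "V_hat M f g l bmin bmax h s (round_up l b) \<ge> V_bar M f g h s b"
proof -
  have "h \<le> Suc (horizon M)" "1 \<le> h" using assms(6) by auto
  then show ?thesis using assms(7,8)
  proof (induction h arbitrary: s b rule: inc_induct)
    case base
    \<comment> \<open>Rounding up preserves nonnegativity, so the approximate terminal value is 0
      whenever the exact one is.\<close>
    have "0 \<le> round_up l b" if "0 \<le> b"
      using that round_up_nth_bounds(1)[OF assms(3), of b]
      by (auto simp: less_eq_vec_def intro: order_trans)
    then show ?case by (auto simp: V_hat.simps V_bar.simps)
  next
    case (step h)
    let ?W = "\<lambda>V a bs. ereal (reward M h s a) + (\<Sum>s'\<in>{s' \<in> states M. trans_prob M h s a s' > 0}.
              ereal (trans_prob M h s a s') * V (Suc h) s' (bs s'))"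
    let ?P = "\<lambda>a bs. a \<in> actions M h s \<and> bs \<in> states M \<rightarrow>\<^sub>E cost_values M f g \<and>
         cost M h s a + f_iter f (num_states M) (\<lambda>s'. g (trans_prob M h s a s') *\<^sub>R bs s') \<le> b"
    let ?Q = "\<lambda>a bs. (a, bs) \<in> approx_actions M f g l bmin bmax h s (round_up l b)"
    let ?A = "{?W (V_bar M f g) a bs | a bs. ?P a bs}"
    let ?B = "{?W (V_hat M f g l bmin bmax) a bs | a bs. ?Q a bs}"
    have acts: "finite (actions M h s)"
      and prob: "\<And>a. a \<in> actions M h s \<Longrightarrow> prob_vector (num_states M) (trans_prob M h s a)"
      and S: "num_states M \<ge> 1"
      using assms(1) step.hyps step.prems by (auto simp: valid_ca_mdp_def states_def)
    have finS: "finite (states M)" by (simp add: states_def)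
    \<comment> \<open>\<open>max_val\<close> is defined through \<open>Max\<close>, so both value
      sets must be shown finite before they can be compared.\<close>
    have "finite ((\<lambda>(a, bs). ?W (V_bar M f g) a bs) `
        (actions M h s \<times> (states M \<rightarrow>\<^sub>E cost_values M f g)))"
      using acts finS finite_cost_values[OF assms(1)]
      by (intro finite_imageI finite_cartesian_product finite_PiE) auto
    then have finA: "finite ?A" by (rule rev_finite_subset) auto
    have "finite ((\<lambda>(a, bs). ?W (V_hat M f g l bmin bmax) a bs) `
        (actions M h s \<times> (states M \<rightarrow>\<^sub>E approx_budgets l bmin bmax)))"
      using acts finS finite_approx_budgets[OF assms(3)]
      by (intro finite_imageI finite_cartesian_product finite_PiE) auto
    then have finB: "finite ?B" by (rule rev_finite_subset) (auto simp: approx_actions_def)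
    have "\<exists>y\<in>?B. x \<le> y" if "x \<in> ?A" for x
    proof -
      from that obtain a bs where x: "x = ?W (V_bar M f g) a bs" and P: "?P a bs" by blast
      define bs' where "bs' = restrict (\<lambda>s'. round_up l (bs s')) (states M)"
      have "?Q a bs'"
        unfolding bs'_def using assms(2,3,5) P prob S
        by (intro round_up_mem_approx_actions) auto
      moreover have "x \<le> ?W (V_hat M f g l bmin bmax) a bs'"
        unfolding x
      \<comment> \<open>In \<open>ereal\<close>, addition and multiplication by a nonnegative
        constant are monotone even at minus infinity, so infeasible successors need no separate
        case.\<close>
      proof (intro add_left_mono sum_mono ereal_mult_left_mono)
        fix s' assume s': "s' \<in> {s' \<in> states M. trans_prob M h s a s' > 0}"
        \<comment> \<open>Successor budgets are again cost values, so the induction hypothesis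
          applies to them; \<open>bs' s'\<close> is the rounding that it speaks of.\<close>
        then have "bs s' \<in> cost_values M f g" using P by auto
        then show "V_bar M f g (Suc h) s' (bs s') \<le> V_hat M f g l bmin bmax (Suc h) s' (bs' s')"
          using step.IH[of s' "bs s'"] s' by (simp add: bs'_def)
      qed auto
      ultimately show ?thesis by blast
    qed
    then have "max_val ?A \<le> max_val ?B" by (rule max_val_mono[OF finA finB])
    moreover have "V_bar M f g h s b = max_val ?A"
      using step.hyps by (subst V_bar.simps) simp
    moreover have "V_hat M f g l bmin bmax h s (round_up l b) = max_val ?B"
      using step.hyps by (subst V_hat.simps) simp
    ultimately show ?case by simp
  qed
qed

end
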